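(* For $m(x)=\prod_{j=1}^nx_j$ and $-\ell=u=1$, there exist precisely $n+3$ core facets of $\operatorname{conv}(G)$, and these are $$1-y\ge 0\quad\text{and}\quad 1+y\ge 0,$$ $$(n-1)+\sum_{j=1}^nx_j+(-1)^ny\ge 0,$$ $$(n-1)-\sum_{j=1}^nx_j+y\ge 0,$$ $$(n-1)-\left(\sum_{j=1}^{t+1}x_j-\sum_{j=t+2}^nx_j\right)+(-1)^{n-(t+1)}y\ge 0,\qquad \forall\, t\in\{0,\dots,n-2\}.$$
   Context: Here $n$ is the number of variables, $\ell<u$ are the common lower and upper bounds on all variables, and $G=\{(x,y)\in\mathbb{R}^n\times\mathbb{R}: \ell\le x_j\le u\ (j=1,\dots,n),\ y=m(x)\}$ is the graph of $m$ over the box $[\ell,u]^n$ (so the box is $[-1,1]^n$ when $-\ell=u=1$). The convex hull $\operatorname{conv}(G)$ is a full-dimensional polytope in $\mathbb{R}^{n+1}$. A core inequality is a linear inequality $\beta_0+\sum_{j=1}^n\beta_jx_j+\beta' y\ge 0$ with $\beta'\in\{-1,1\}$ and $\beta_1\le\cdots\le\beta_n$. A valid core inequality is a core inequality satisfied by all points of $\operatorname{conv}(G)$; a core facet is a valid core inequality that is facet-defining for $\operatorname{conv}(G)$, i.e., the set of points of $\operatorname{conv}(G)$ satisfying it with equality is a facet of $\operatorname{conv}(G)$.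
   Formalization: The formal theorem assumes n ≥ 3; for n = 2, conv(G) is a tetrahedron on which 1−y=0 and 1+y=0 are only edges, so there are 3 core facets rather than n+3=5, and for n ≤ 1 conv(G) is not full-dimensional and the claim fails. *)

theory Defs
  imports "HOL-Analysis.Analysis"
begin

text \<open>
  The ambient space is \<open>real^'n \<times> real\<close> with points \<open>(x, y)\<close>. The variables are numbered by
  \<open>v :: nat \<Rightarrow> 'n\<close>, in the theorem a bijection from \<open>{1..n}\<close> onto the index type,
  so that \<open>x $ v j\<close> is the coordinate \<open>x\<^sub>j\<close>.
\<close>

definition graph_over_box ::
    "(real^'n \<Rightarrow> real) \<Rightarrow> real \<Rightarrow> real \<Rightarrow> ((real^'n) \<times> real) set" where
  "graph_over_box m l u = {(x, y). (\<forall>i. l \<le> x $ i \<and> x $ i \<le> u) \<and> y = m x}"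

text \<open>
  A linear inequality \<open>f (x, y) \<ge> 0\<close> is represented by its left-hand side \<open>f\<close>. As an affine
  function on the whole space determines its coefficients, two inequalities are equal exactly when
  \<open>\<beta>\<^sub>0\<close>, the \<open>\<beta> j\<close> for \<open>1 \<le> j \<le> n\<close>, and \<open>\<beta>'\<close> agree.
\<close>

definition core_inequality ::
    "nat \<Rightarrow> (nat \<Rightarrow> 'n::finite) \<Rightarrow> ((real^'n) \<times> real \<Rightarrow> real) \<Rightarrow> bool" where
  "core_inequality n v f \<longleftrightarrow>
     (\<exists>(\<beta>\<^sub>0::real) (\<beta>::nat \<Rightarrow> real) (\<beta>'::real).
        \<beta>' \<in> {-1, 1} \<and> mono_on {1..n} \<beta> \<and>
        f = (\<lambda>(x, y). \<beta>\<^sub>0 + (\<Sum>j=1..n. \<beta> j * x $ v j) + \<beta>' * y))"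

definition valid_core_inequality ::
    "nat \<Rightarrow> (nat \<Rightarrow> 'n::finite) \<Rightarrow> (real^'n \<Rightarrow> real) \<Rightarrow> real \<Rightarrow> real \<Rightarrow>
     ((real^'n) \<times> real \<Rightarrow> real) \<Rightarrow> bool" where
  "valid_core_inequality n v m l u f \<longleftrightarrow>
     core_inequality n v f \<and> (\<forall>p \<in> convex hull (graph_over_box m l u). f p \<ge> 0)"

definition core_facet ::
    "nat \<Rightarrow> (nat \<Rightarrow> 'n::finite) \<Rightarrow> (real^'n \<Rightarrow> real) \<Rightarrow> real \<Rightarrow> real \<Rightarrow>
     ((real^'n) \<times> real \<Rightarrow> real) \<Rightarrow> bool" where
  "core_facet n v m l u f \<longleftrightarrow>
     valid_core_inequality n v m l u f \<and>
     {p \<in> convex hull (graph_over_box m l u). f p = 0} facet_of convex hull (graph_over_box m l u)"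

end

theory Submission
  imports Defs
begin

text \<open>
  The product is affine in each variable separately, so the convex hull \<open>P\<close> of its graph over
  \<open>[-1, 1]\<^sup>n\<close> is the convex hull of the finitely many points \<open>(x, m x)\<close> with \<open>x\<close> a sign vector
  (\<open>convex_hull_graph_eq\<close>). It is full-dimensional, so a valid inequality defines a facet exactly
  when every affine functional that vanishes at its tight vertices is a multiple of it
  (\<open>facet_iff_functionals_proportional\<close>). The criterion takes the place of exhibiting
  affinely independent tight vertices.

  Consider a facet \<open>b \<bullet> x + \<beta>' y + b0 \<ge> 0\<close> with \<open>\<beta>' = 1\<close> or \<open>\<beta>' = -1\<close>. If every tight vertex has
  \<open>m x = -\<beta>'\<close>, then \<open>y + \<beta>'\<close> vanishes at all of them, so the inequality is \<open>1 + \<beta>' y \<ge> 0\<close>.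
  Otherwise some tight \<open>p\<close> has \<open>m p = \<beta>'\<close>. Flipping the sign of \<open>p\<^sub>i\<close> reverses the sign of the
  product, so validity at the flipped vertex says \<open>- b\<^sub>i p\<^sub>i \<ge> 1\<close>. If this is strict for some \<open>i\<close>,
  then a vertex that differs from \<open>p\<close> in coordinate \<open>i\<close> cannot be tight; hence \<open>x\<^sub>i - p\<^sub>i\<close>
  vanishes at all tight vertices, although it does not involve \<open>y\<close> and so is not a multiple of the
  facet inequality. Therefore \<open>b = -p\<close>, which determines \<open>b0 = n - 1\<close> and \<open>\<beta>' = m (-b)\<close>
  (\<open>facet_imp_parity_or_sign\<close>).

  Conversely, these inequalities are valid (\<open>parity_or_sign_nonneg\<close>) and satisfy the criterion
  (\<open>parity_or_sign_functionals\<close>): the tight vertices are one parity class in the first case, and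
  \<open>-b\<close> together with its \<open>n\<close> neighbours in the cube in the second. Finally, a sign vector with
  nondecreasing coefficients is \<open>-1\<close> up to some position \<open>k\<close> in \<open>{0..n}\<close> and \<open>1\<close> after it. This
  gives \<open>n + 1\<close> inequalities besides \<open>1 - y \<ge> 0\<close> and \<open>1 + y \<ge> 0\<close>.
\<close>

section \<open>Facets and affine functionals vanishing on tight vertices\<close>

lemma nonneg_on_convex_hull:
  fixes a :: "'a::euclidean_space"
  shows "(\<forall>p \<in> convex hull V. 0 \<le> a \<bullet> p + b) \<longleftrightarrow> (\<forall>p \<in> V. 0 \<le> a \<bullet> p + b)"
proof
  assume nn: "\<forall>p \<in> V. 0 \<le> a \<bullet> p + b"
  have "V \<subseteq> {p. a \<bullet> p \<ge> - b}"
  proof clarify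
    fix p assume "p \<in> V"
    with nn have "0 \<le> a \<bullet> p + b" by blast
    then show "a \<bullet> p \<ge> - b" by linarith
  qed
  then have hull: "convex hull V \<subseteq> {p. a \<bullet> p \<ge> - b}"
    by (rule hull_minimal) (rule convex_halfspace_ge)
  show "\<forall>p \<in> convex hull V. 0 \<le> a \<bullet> p + b"
  proof
    fix p assume "p \<in> convex hull V"
    with hull have "a \<bullet> p \<ge> - b" by blast
    then show "0 \<le> a \<bullet> p + b" by linarith
  qed
qed (simp add: hull_inc)

text \<open>
  A face of a polytope is the hull of the vertices that it contains, so statements about the face
  reduce to statements about the tight vertices.
\<close>

lemma tight_face_eq_hull:
  fixes a :: "'a::euclidean_space"
  assumes fin: "finite V" and nn: "\<And>p. p \<in> V \<Longrightarrow> 0 \<le> a \<bullet> p + b"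
  shows "{p \<in> convex hull V. a \<bullet> p + b = 0} face_of convex hull V"
    and "{p \<in> convex hull V. a \<bullet> p + b = 0} = convex hull {p \<in> V. a \<bullet> p + b = 0}"
proof -
  let ?F = "{p \<in> convex hull V. a \<bullet> p + b = 0}"
  have nn': "0 \<le> a \<bullet> p + b" if "p \<in> convex hull V" for p
    using nonneg_on_convex_hull[of V a b] nn that by blast
  have F: "?F = convex hull V \<inter> {p. a \<bullet> p = - b}" by (auto simp: eq_neg_iff_add_eq_0)
  show face: "?F face_of convex hull V"
    unfolding F
  proof (rule face_of_Int_supporting_hyperplane_ge)
    show "a \<bullet> p \<ge> - b" if "p \<in> convex hull V" for p using nn'[OF that] by linarith
  qed (rule convex_convex_hull)
  obtain S where S: "S \<subseteq> V" "?F = convex hull S"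
    using face_of_convex_hull_subset[OF finite_imp_compact[OF fin] face] by blast
  have "S \<subseteq> ?F" unfolding S(2) by (rule hull_subset)
  then have "S \<subseteq> {p \<in> V. a \<bullet> p + b = 0}" using S(1) by auto
  then have sub: "?F \<subseteq> convex hull {p \<in> V. a \<bullet> p + b = 0}" unfolding S(2) by (rule hull_mono)
  have "convex hull {p \<in> V. a \<bullet> p + b = 0} \<subseteq> ?F"
  proof (rule hull_minimal)
    show "{p \<in> V. a \<bullet> p + b = 0} \<subseteq> ?F" using hull_subset[of V convex] by auto
    show "convex ?F" using face face_of_imp_convex by blast
  qed
  with sub show "?F = convex hull {p \<in> V. a \<bullet> p + b = 0}" by (rule equalityI)
qed

text \<open>
  The part of \<open>h\<close> orthogonal to \<open>a\<close> is a direction of the hyperplane, so \<open>h\<close> is constant along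
  it; this forces that part to be zero.
\<close>

lemma affine_functional_vanishing_on_hyperplane:
  fixes a h :: "'a::euclidean_space"
  assumes "a \<noteq> 0" and van: "\<And>p. a \<bullet> p + b = 0 \<Longrightarrow> h \<bullet> p + k = 0"
  shows "\<exists>c. h = c *\<^sub>R a \<and> k = c * b"
proof -
  define p0 where "p0 = (- b / (a \<bullet> a)) *\<^sub>R a"
  define c where "c = (h \<bullet> a) / (a \<bullet> a)"
  define w where "w = h - c *\<^sub>R a"
  have aa: "a \<bullet> a \<noteq> 0" using assms(1) by simp
  have ap: "a \<bullet> p0 + b = 0" using aa by (simp add: p0_def)
  have aw: "a \<bullet> w = 0" using aa by (simp add: w_def c_def inner_diff_right inner_commute)
  have "a \<bullet> (p0 + w) + b = 0" using ap aw by (simp add: inner_add_right)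
  from van[OF this] van[OF ap] have "h \<bullet> w = 0" by (simp add: inner_add_right)
  then have "w \<bullet> w = 0" using aw by (simp add: w_def inner_diff_left)
  then have h: "h = c *\<^sub>R a" by (simp add: w_def)
  have "a \<bullet> p0 = - b" using ap by linarith
  with van[OF ap] have "k = c * b" by (simp add: h)
  with h show ?thesis by blast
qed

text \<open>
  Being a facet means that the tight vertices affinely span the supporting hyperplane. Any functional
  vanishing on them then vanishes on this hyperplane and is a multiple of \<open>a \<bullet> p + b\<close>. Conversely,
  if they span less, then some hyperplane contains them and also a point \<open>q\<close> off the supporting one,
  and its equation is not such a multiple.
\<close>

lemma facet_iff_functionals_proportional:
  fixes a :: "'a::euclidean_space"
  assumes fin: "finite V" and full: "aff_dim V = DIM('a)" and "a \<noteq> 0"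
    and nn: "\<And>p. p \<in> V \<Longrightarrow> 0 \<le> a \<bullet> p + b"
  shows "{p \<in> convex hull V. a \<bullet> p + b = 0} facet_of convex hull V \<longleftrightarrow>
    (\<forall>h k. (\<forall>p\<in>V. a \<bullet> p + b = 0 \<longrightarrow> h \<bullet> p + k = 0) \<longrightarrow> (\<exists>c. h = c *\<^sub>R a \<and> k = c * b))"
    (is "?F facet_of _ \<longleftrightarrow> ?R")
proof -
  define T where "T = {p \<in> V. a \<bullet> p + b = 0}"
  let ?H = "{p. a \<bullet> p = - b}"
  have F: "?F = convex hull T" and face: "?F face_of convex hull V"
    using tight_face_eq_hull[OF fin nn] by (auto simp: T_def)
  have affF: "aff_dim ?F = aff_dim T" by (simp only: F aff_dim_convex_hull)
  have TH: "T \<subseteq> ?H" by (auto simp: T_def)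
  have DIM: "int DIM('a) \<ge> 1" using DIM_positive[where 'a='a] by linarith
  have dimH: "aff_dim ?H = int DIM('a) - 1"
    using aff_dim_hyperplane[OF \<open>a \<noteq> 0\<close>, of "- b"] DIM by (simp add: of_nat_diff)
  have facet: "?F facet_of convex hull V \<longleftrightarrow> aff_dim T = int DIM('a) - 1"
  proof -
    have "?F \<noteq> {}" if "aff_dim T = int DIM('a) - 1"
    proof
      assume "?F = {}"
      then have "aff_dim T = -1" using affF by (simp only: aff_dim_empty)
      with that DIM show False by linarith
    qed
    then show ?thesis unfolding facet_of_def affF aff_dim_convex_hull full using face by blast
  qed
  show ?thesis
  proof
    assume "?F facet_of convex hull V"
    then have dT: "aff_dim T = aff_dim ?H" using facet dimH by simp
    have "affine hull T = affine hull ?H"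
      using aff_dim_eq_full_gen[OF TH] dT by blast
    then have hull: "affine hull T = ?H" by (simp add: affine_hyperplane hull_same)
    show ?R
    proof (intro allI impI)
      fix h k assume van: "\<forall>p\<in>V. a \<bullet> p + b = 0 \<longrightarrow> h \<bullet> p + k = 0"
      then have "T \<subseteq> {p. h \<bullet> p = - k}" by (auto simp: T_def)
      then have "affine hull T \<subseteq> {p. h \<bullet> p = - k}"
        by (rule hull_minimal) (rule affine_hyperplane)
      then show "\<exists>c. h = c *\<^sub>R a \<and> k = c * b"
        by (intro affine_functional_vanishing_on_hyperplane[OF \<open>a \<noteq> 0\<close>])
           (use hull in \<open>force simp: eq_neg_iff_add_eq_0\<close>)
    qed
  next
    assume R: ?R
    \<comment> \<open>Any point off the hyperplane would do; at this one the functional takes the value 1.\<close>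
    define q where "q = ((1 - b) / (a \<bullet> a)) *\<^sub>R a"
    have q: "a \<bullet> q + b = 1" using \<open>a \<noteq> 0\<close> by (simp add: q_def)
    have "aff_dim T = int DIM('a) - 1"
    proof (rule ccontr)
      assume "aff_dim T \<noteq> int DIM('a) - 1"
      then have "aff_dim T < int DIM('a) - 1" using aff_dim_subset[OF TH] dimH by linarith
      then have "aff_dim (insert q T) < DIM('a)" by (simp add: aff_dim_insert)
      then obtain h k where h: "h \<noteq> 0" "insert q T \<subseteq> {p. h \<bullet> p = k}"
        using aff_lowdim_subset_hyperplane by metis
      then have "\<forall>p\<in>V. a \<bullet> p + b = 0 \<longrightarrow> h \<bullet> p + (- k) = 0" by (auto simp: T_def)
      with R obtain c where c: "h = c *\<^sub>R a" "- k = c * b" by blast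
      have "c * (a \<bullet> q + b) = h \<bullet> q - k" using c by (simp add: algebra_simps)
      also have "\<dots> = 0" using h by simp
      finally have "c = 0" using q by simp
      with c h show False by simp
    qed
    then show "?F facet_of convex hull V" using facet by simp
  qed
qed

section \<open>The convex hull of the graph of the product\<close>

definition sign_vectors :: "(real^'n) set" where
  "sign_vectors = {x. \<forall>i. x $ i = 1 \<or> x $ i = -1}"

definition flip :: "'n \<Rightarrow> real^'n \<Rightarrow> real^'n" where
  "flip i x = (\<chi> k. if k = i then - x $ k else x $ k)"

definition product_vertices :: "((real^'n) \<times> real) set" where
  "product_vertices = (\<lambda>x. (x, \<Prod>i\<in>UNIV. x $ i)) ` sign_vectors"

lemma sign_vectorsD: "x \<in> sign_vectors \<Longrightarrow> x $ i = 1 \<or> x $ i = -1"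
  by (simp add: sign_vectors_def)

lemma sign_vectors_square: "x \<in> sign_vectors \<Longrightarrow> x $ i * x $ i = 1"
  by (drule sign_vectorsD[of _ i]) auto

lemma finite_product_vertices: "finite (product_vertices :: ((real^'n) \<times> real) set)"
proof -
  have "(x :: real^'n) \<in> range (\<lambda>A. \<chi> i. if i \<in> A then 1 else -1)" if "x \<in> sign_vectors" for x
    by (rule image_eqI[of _ _ "{i. x $ i = 1}"])
       (use sign_vectorsD[OF that] in \<open>auto simp: vec_eq_iff\<close>)
  then have "(sign_vectors :: (real^'n) set) \<subseteq> range (\<lambda>A. \<chi> i. if i \<in> A then 1 else -1)" by blast
  then have "finite (sign_vectors :: (real^'n) set)" by (rule finite_subset) simp
  then show ?thesis by (simp add: product_vertices_def)
qed

lemma flip_nth [simp]: "flip i x $ k = (if k = i then - x $ k else x $ k)"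
  by (simp add: flip_def)

lemma flip_sign_vectors: "x \<in> sign_vectors \<Longrightarrow> flip i x \<in> sign_vectors"
  by (auto simp: sign_vectors_def)

text \<open>
  Adjacent vertices of the cube lie on opposite parity classes; this interplay of a single sign change
  with the product drives the whole classification.
\<close>

lemma prod_flip: "(\<Prod>k\<in>UNIV. flip i x $ k) = - (\<Prod>k\<in>UNIV. x $ k)"
proof -
  have "(\<Prod>k\<in>UNIV. flip i x $ k) = flip i x $ i * (\<Prod>k\<in>UNIV - {i}. flip i x $ k)"
    by (rule prod.remove) auto
  also have "(\<Prod>k\<in>UNIV - {i}. flip i x $ k) = (\<Prod>k\<in>UNIV - {i}. x $ k)"
    by (rule prod.cong) auto
  also have "flip i x $ i * \<dots> = - (x $ i * \<dots>)" by simp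
  also have "x $ i * (\<Prod>k\<in>UNIV - {i}. x $ k) = (\<Prod>k\<in>UNIV. x $ k)"
    by (rule prod.remove[symmetric]) auto
  finally show ?thesis .
qed

lemma inner_flip: "c \<bullet> flip i x = c \<bullet> x - 2 * c $ i * x $ i"
proof -
  have "flip i x = x - (2 * x $ i) *\<^sub>R axis i 1" by (auto simp: vec_eq_iff axis_def)
  then show ?thesis by (simp add: inner_diff_right inner_axis)
qed

lemma prod_sign_vectors: "x \<in> sign_vectors \<Longrightarrow> (\<Prod>i\<in>UNIV. x $ i) \<in> {1, -1}"
proof -
  assume x: "x \<in> sign_vectors"
  have "(\<Prod>i\<in>A. x $ i) \<in> {1, -1}" for A
    by (induction A rule: infinite_finite_induct) (use sign_vectorsD[OF x] in force)+
  then show ?thesis .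
qed

text \<open>
  Moving one coordinate of \<open>x\<close> to \<open>-1\<close> or to \<open>1\<close> changes the product affinely, so the point of the
  graph lies on the segment between the two results. Each such step leaves one coordinate fewer
  outside \<open>{-1, 1}\<close>.
\<close>

lemma graph_point_in_hull:
  fixes x :: "real^'n"
  assumes "\<And>i. \<bar>x $ i\<bar> \<le> 1"
  shows "(x, \<Prod>i\<in>UNIV. x $ i) \<in> convex hull product_vertices"
  using assms
proof (induction "card {i. \<bar>x $ i\<bar> \<noteq> 1}" arbitrary: x)
  case 0
  then have "x \<in> sign_vectors" by (auto simp: sign_vectors_def abs_eq_iff')
  then show ?case by (intro hull_inc) (auto simp: product_vertices_def)
next
  case (Suc d)
  then obtain i where i: "\<bar>x $ i\<bar> \<noteq> 1"
    by (metis (mono_tags, lifting) Collect_empty_eq card.empty nat.distinct(1))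
  define z where "z s = (\<chi> k. if k = i then s else x $ k)" for s :: real
  have z: "(z s, \<Prod>k\<in>UNIV. z s $ k) \<in> convex hull product_vertices" if "\<bar>s\<bar> = 1" for s
  proof (rule Suc.hyps(1))
    have "{k. \<bar>z s $ k\<bar> \<noteq> 1} = {k. \<bar>x $ k\<bar> \<noteq> 1} - {i}" using that by (auto simp: z_def)
    then show "d = card {k. \<bar>z s $ k\<bar> \<noteq> 1}" using Suc.hyps(2) i by simp
    show "\<bar>z s $ k\<bar> \<le> 1" for k using Suc.prems that by (simp add: z_def)
  qed
  have prod_z: "(\<Prod>k\<in>UNIV. z s $ k) = s * (\<Prod>k\<in>UNIV - {i}. x $ k)" for s
  proof -
    have "(\<Prod>k\<in>UNIV. z s $ k) = z s $ i * (\<Prod>k\<in>UNIV - {i}. z s $ k)"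
      by (rule prod.remove) auto
    also have "(\<Prod>k\<in>UNIV - {i}. z s $ k) = (\<Prod>k\<in>UNIV - {i}. x $ k)"
      by (rule prod.cong) (auto simp: z_def)
    finally show ?thesis by (simp add: z_def)
  qed
  have zx: "z (x $ i) = x" by (auto simp: z_def vec_eq_iff)
  \<comment> \<open>The weight of the endpoint 1 in the convex combination of \<open>-1\<close> and 1 that gives \<open>x $ i\<close>.\<close>
  define \<mu> where "\<mu> = (1 + x $ i) / 2"
  have \<mu>: "0 \<le> \<mu>" "0 \<le> 1 - \<mu>" "x $ i = 2 * \<mu> - 1"
    using Suc.prems[of i] by (auto simp: \<mu>_def field_simps)
  have "(1 - \<mu>) *\<^sub>R (z (-1), \<Prod>k\<in>UNIV. z (-1) $ k) + \<mu> *\<^sub>R (z 1, \<Prod>k\<in>UNIV. z 1 $ k)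
      \<in> convex hull product_vertices"
    by (rule convexD) (use \<mu> z in \<open>auto simp: convex_convex_hull\<close>)
  also have "(1 - \<mu>) *\<^sub>R (z (-1), \<Prod>k\<in>UNIV. z (-1) $ k) + \<mu> *\<^sub>R (z 1, \<Prod>k\<in>UNIV. z 1 $ k)
      = (z (x $ i), \<Prod>k\<in>UNIV. z (x $ i) $ k)"
    unfolding prod_z \<mu>(3) by (auto simp: z_def vec_eq_iff algebra_simps)
  finally show ?case by (simp add: zx)
qed

lemma convex_hull_graph_eq:
  assumes m: "\<And>x::real^'n. m x = (\<Prod>i\<in>UNIV. x $ i)"
  shows "convex hull (graph_over_box m (-1) 1) = convex hull product_vertices"
proof
  show "convex hull (graph_over_box m (-1) 1) \<subseteq> convex hull product_vertices"
    by (rule hull_minimal)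
       (auto simp: graph_over_box_def m abs_le_iff minus_le_iff intro!: graph_point_in_hull)
  have "- 1 \<le> x $ i \<and> x $ i \<le> 1" if "x \<in> sign_vectors" for x :: "real^'n" and i
    using sign_vectorsD[OF that, of i] by auto
  then have "product_vertices \<subseteq> graph_over_box m (-1) 1"
    by (auto simp: product_vertices_def graph_over_box_def m)
  then show "convex hull product_vertices \<subseteq> convex hull (graph_over_box m (-1) 1)"
    by (rule hull_mono)
qed

text \<open>
  For \<open>n \<ge> 3\<close> each parity class affinely spans \<open>\<real>\<^sup>n\<close>: flipping two coordinates \<open>i\<close> and \<open>j\<close> stays in
  the class and yields \<open>c\<^sub>i x\<^sub>i + c\<^sub>j x\<^sub>j = 0\<close>, and a third coordinate can be used to adjust the parity,
  so that \<open>x\<^sub>i\<close> and \<open>x\<^sub>j\<close> may be chosen with equal and with opposite signs. For \<open>n = 2\<close> a class has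
  only two points and the conclusion fails.
\<close>

lemma functional_on_parity_class:
  fixes c :: "real^'n"
  assumes card: "CARD('n) \<ge> 3" and "\<epsilon> \<in> {1, -1}"
    and van: "\<And>x. x \<in> sign_vectors \<Longrightarrow> (\<Prod>i\<in>UNIV. x $ i) = \<epsilon> \<Longrightarrow> c \<bullet> x + k = 0"
  shows "c = 0 \<and> k = 0"
proof -
  have ex: "\<exists>x::real^'n. x \<in> sign_vectors \<and> (\<Prod>i\<in>UNIV. x $ i) = \<epsilon> \<and> x $ i = 1 \<and> x $ j = s"
    if "i \<noteq> j" "s \<in> {1,-1}" for i j :: 'n and s
  proof -
    have "card {i, j} < CARD('n)" using card that by simp
    then have "{i, j} \<noteq> UNIV" by (metis less_irrefl)
    then obtain l where l: "l \<noteq> i" "l \<noteq> j" by blast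
    define z :: "real^'n" where "z = (\<chi> k. if k = j then s else 1)"
    have z: "z \<in> sign_vectors" using that by (auto simp: z_def sign_vectors_def)
    show ?thesis
    proof (cases "(\<Prod>i\<in>UNIV. z $ i) = \<epsilon>")
      case True
      then show ?thesis using z that by (intro exI[of _ z]) (auto simp: z_def)
    next
      case False
      then have "(\<Prod>i\<in>UNIV. flip l z $ i) = \<epsilon>"
        using prod_sign_vectors[OF z] assms(2) unfolding prod_flip by auto
      then show ?thesis using flip_sign_vectors[OF z] that l
        by (intro exI[of _ "flip l z"]) (auto simp: z_def)
    qed
  qed
  have ci: "c $ i = 0" for i
  proof -
    have "card {i} < CARD('n)" using card by simp
    then have "{i} \<noteq> UNIV" by (metis less_irrefl)
    then obtain j where j: "i \<noteq> j" by (metis UNIV_eq_I insertI1)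
    have "c $ i + c $ j * s = 0" if s: "s \<in> {1, -1}" for s
    proof -
      obtain x where x: "x \<in> sign_vectors" "(\<Prod>i\<in>UNIV. x $ i) = \<epsilon>" "x $ i = 1" "x $ j = s"
        using ex[OF j s] by blast
      have "c \<bullet> flip i (flip j x) + k = 0"
        by (rule van) (simp_all only: prod_flip x flip_sign_vectors minus_minus)
      moreover have "c \<bullet> x + k = 0" by (rule van[OF x(1,2)])
      ultimately show ?thesis using x j by (simp add: inner_flip)
    qed
    from this[of 1] this[of "-1"] show ?thesis by simp
  qed
  then have c: "c = 0" by (simp add: vec_eq_iff)
  have "card {undefined::'n} < CARD('n)" using card by simp
  then have "{undefined::'n} \<noteq> UNIV" by (metis less_irrefl)
  then obtain j :: 'n where "undefined \<noteq> j" by (metis UNIV_eq_I insertI1)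
  from ex[OF this, of 1] van c show ?thesis by force
qed

text \<open>
  A hyperplane through all vertices would cut each of the two parity classes, on which \<open>y\<close> is
  constant, in an affine condition on \<open>x\<close> alone; such a condition is trivial on both, which also
  kills the coefficient of \<open>y\<close>.
\<close>

lemma aff_dim_product_vertices:
  assumes card: "CARD('n) \<ge> 3"
  shows "aff_dim (product_vertices :: ((real^'n) \<times> real) set) = DIM((real^'n) \<times> real)"
proof (rule ccontr)
  let ?V = "product_vertices :: ((real^'n) \<times> real) set"
  assume "aff_dim ?V \<noteq> DIM((real^'n) \<times> real)"
  then have "aff_dim ?V < DIM((real^'n) \<times> real)"
    using aff_dim_le_DIM[of ?V] by linarith
  then obtain h k where h: "h \<noteq> 0" "?V \<subseteq> {p. h \<bullet> p = k}"
    using aff_lowdim_subset_hyperplane by metis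
  obtain c d where cd: "h = (c, d)" by fastforce
  have van: "c \<bullet> x + (d * (\<Prod>i\<in>UNIV. x $ i) - k) = 0" if "x \<in> sign_vectors" for x
    using h(2) that unfolding product_vertices_def cd by auto
  have "c = 0 \<and> d * \<epsilon> - k = 0" if "\<epsilon> \<in> {1, -1}" for \<epsilon>
    by (rule functional_on_parity_class[OF card that]) (use van in auto)
  from this[of 1] this[of "-1"] have "c = 0" "d = 0" by auto
  with h cd show False by (simp add: zero_prod_def)
qed

section \<open>Classification of the facets with coefficient 1 or -1 at y\<close>

text \<open>
  The assumption \<open>multiple\<close> is the facet criterion, written out at the vertices.
\<close>

lemma facet_imp_parity_or_sign:
  fixes b :: "real^'n"
  assumes \<beta>': "\<beta>' \<in> {1, -1}"
    and nn: "\<And>x. x \<in> sign_vectors \<Longrightarrow> 0 \<le> b \<bullet> x + \<beta>' * (\<Prod>i\<in>UNIV. x $ i) + b0"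
    and multiple: "\<And>c d k. (\<And>x. x \<in> sign_vectors \<Longrightarrow> b \<bullet> x + \<beta>' * (\<Prod>i\<in>UNIV. x $ i) + b0 = 0 \<Longrightarrow>
        c \<bullet> x + d * (\<Prod>i\<in>UNIV. x $ i) + k = 0) \<Longrightarrow> \<exists>r. c = r *\<^sub>R b \<and> d = r * \<beta>' \<and> k = r * b0"
  shows "b = 0 \<and> b0 = 1 \<or>
    b \<in> sign_vectors \<and> b0 = real CARD('n) - 1 \<and> \<beta>' = (\<Prod>i\<in>UNIV. - b $ i)"
proof (cases "\<exists>p \<in> sign_vectors. b \<bullet> p + \<beta>' * (\<Prod>i\<in>UNIV. p $ i) + b0 = 0 \<and> (\<Prod>i\<in>UNIV. p $ i) = \<beta>'")
  case False
  \<comment> \<open>All tight vertices have product \<open>-\<beta>'\<close>: apply the criterion to the functional \<open>y + \<beta>'\<close>.\<close>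
  have "\<exists>r. (0::real^'n) = r *\<^sub>R b \<and> 1 = r * \<beta>' \<and> \<beta>' = r * b0"
    by (rule multiple) (use False prod_sign_vectors \<beta>' in fastforce)
  then obtain r where r: "0 = r *\<^sub>R b" "1 = r * \<beta>'" "\<beta>' = r * b0" by blast
  then have "r = \<beta>'" "r \<noteq> 0" using \<beta>' by auto
  then show ?thesis using r \<beta>' by auto
next
  case True
  then obtain p where p: "p \<in> sign_vectors" "b \<bullet> p + \<beta>' * \<beta>' + b0 = 0" "(\<Prod>i\<in>UNIV. p $ i) = \<beta>'"
    by metis
  have sq: "\<beta>' * \<beta>' = 1" using \<beta>' by auto
  \<comment> \<open>Compare \<open>p\<close>, where the inequality is tight, with its neighbour in direction \<open>i\<close>.\<close>
  have ge: "1 \<le> - b $ i * p $ i" for i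
    using nn[OF flip_sign_vectors[OF p(1)], of i] p(2) sq unfolding prod_flip p(3)
    by (simp add: inner_flip)
  have eq: "b $ i * p $ i = - 1" for i
  proof (rule ccontr)
    assume "b $ i * p $ i \<noteq> - 1"
    with ge[of i] have gt: "1 < - b $ i * p $ i" by linarith
    \<comment> \<open>By \<open>ge\<close>, leaving \<open>p\<close> never decreases \<open>b \<bullet> x\<close>, and changing coordinate \<open>i\<close> adds more than 2,
      while the term with the product can lose at most 2.\<close>
    have agree: "x $ i = p $ i"
      if x: "x \<in> sign_vectors" and t: "b \<bullet> x + \<beta>' * (\<Prod>i\<in>UNIV. x $ i) + b0 = 0" for x
    proof (rule ccontr)
      assume ne: "x $ i \<noteq> p $ i"
      have diff: "b \<bullet> x - b \<bullet> p = (\<Sum>j\<in>UNIV. b $ j * (x $ j - p $ j))"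
        by (simp add: inner_vec_def sum_subtractf right_diff_distrib)
      have "b $ j * (x $ j - p $ j) \<ge> 0" for j
        using ge[of j] sign_vectorsD[OF x, of j] sign_vectorsD[OF p(1), of j] by auto
      then have "b $ i * (x $ i - p $ i) \<le> b \<bullet> x - b \<bullet> p"
        unfolding diff by (intro member_le_sum) auto
      moreover have "b $ i * (x $ i - p $ i) > 2"
        using gt ne sign_vectorsD[OF x, of i] sign_vectorsD[OF p(1), of i] by auto
      moreover have "\<beta>' * (\<Prod>i\<in>UNIV. x $ i) \<ge> -1" using prod_sign_vectors[OF x] \<beta>' by auto
      ultimately show False using t p(2) sq by linarith
    qed
    \<comment> \<open>The functional \<open>x\<^sub>i - p\<^sub>i\<close> has coefficient 0 at \<open>y\<close>, whereas \<open>\<beta>'\<close> is nonzero.\<close>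
    have "\<exists>r. axis i 1 = r *\<^sub>R b \<and> 0 = r * \<beta>' \<and> - p $ i = r * b0"
      by (rule multiple) (use agree in \<open>auto simp: inner_axis'\<close>)
    then show False using \<beta>' by auto
  qed
  have b: "b = - p"
  proof -
    have "b $ i = - p $ i" for i using eq[of i] sign_vectorsD[OF p(1), of i] by auto
    then show ?thesis by (simp add: vec_eq_iff)
  qed
  have "b \<bullet> p = (\<Sum>i\<in>(UNIV::'n set). -1)"
    unfolding inner_vec_def by (rule sum.cong) (use eq in auto)
  then have "b0 = real CARD('n) - 1" using p(2) sq by simp
  moreover have "b \<in> sign_vectors" using p(1) by (auto simp: b sign_vectors_def)
  moreover have "\<beta>' = (\<Prod>i\<in>UNIV. - b $ i)" using p(3) by (simp add: b)
  ultimately show ?thesis by blast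
qed

text \<open>
  For a sign vector \<open>b\<close>, the sum \<open>b \<bullet> x\<close> has its minimum \<open>-n\<close> only at \<open>x = -b\<close>, where the product
  compensates; at every other vertex it is at least \<open>2 - n\<close>, and the term \<open>\<beta>' y \<ge> -1\<close> does no harm.
\<close>

lemma parity_or_sign_nonneg:
  fixes b x :: "real^'n"
  assumes \<beta>': "\<beta>' \<in> {1, -1}" and x: "x \<in> sign_vectors"
    and b: "b = 0 \<and> b0 = 1 \<or>
      b \<in> sign_vectors \<and> b0 = real CARD('n) - 1 \<and> \<beta>' = (\<Prod>i\<in>UNIV. - b $ i)"
  shows "0 \<le> b \<bullet> x + \<beta>' * (\<Prod>i\<in>UNIV. x $ i) + b0"
proof -
  have ge: "\<beta>' * (\<Prod>i\<in>UNIV. x $ i) \<ge> -1" using prod_sign_vectors[OF x] \<beta>' by auto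
  show ?thesis using b
  proof (elim disjE conjE)
    assume bs: "b \<in> sign_vectors" and b0: "b0 = real CARD('n) - 1"
      and \<beta>'_eq: "\<beta>' = (\<Prod>i\<in>UNIV. - b $ i)"
    have sum: "b \<bullet> x + real CARD('n) = (\<Sum>i\<in>UNIV. 1 + b $ i * x $ i)"
      by (simp add: inner_vec_def sum.distrib)
    have nonneg: "0 \<le> 1 + b $ i * x $ i" for i
      using sign_vectorsD[OF bs, of i] sign_vectorsD[OF x, of i] by auto
    show ?thesis
    proof (cases "\<exists>i. x $ i = b $ i")
      case True
      then obtain i where i: "x $ i = b $ i" by blast
      have "1 + b $ i * x $ i \<le> (\<Sum>i\<in>UNIV. 1 + b $ i * x $ i)"
        using nonneg by (intro member_le_sum) auto
      then show ?thesis using sum i sign_vectors_square[OF bs, of i] ge b0 by simp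
    next
      case False
      have "x $ i = - b $ i" for i
      proof -
        from False have "x $ i \<noteq> b $ i" by blast
        then show ?thesis using sign_vectorsD[OF bs, of i] sign_vectorsD[OF x, of i] by auto
      qed
      then have "\<beta>' * (\<Prod>i\<in>UNIV. x $ i) = 1" using \<beta>' \<beta>'_eq by auto
      moreover have "(\<Sum>i\<in>UNIV. 1 + b $ i * x $ i) \<ge> 0" using nonneg by (rule sum_nonneg)
      ultimately show ?thesis using sum b0 by linarith
    qed
  qed (use ge in simp)
qed

text \<open>
  For a sign vector \<open>b\<close>, the inequality is tight at \<open>-b\<close> and at its neighbours. Subtracting the
  equation at \<open>-b\<close> from that at its neighbour in direction \<open>i\<close> gives \<open>c\<^sub>i b\<^sub>i = d \<beta>'\<close>, so the
  multiplier is \<open>d \<beta>'\<close>. The same multiplier works for the inequality \<open>1 + \<beta>' y \<ge> 0\<close>, which is tight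
  on a whole parity class.
\<close>

lemma parity_or_sign_functionals:
  fixes b c :: "real^'n"
  assumes card: "CARD('n) \<ge> 3" and \<beta>': "\<beta>' \<in> {1, -1}"
    and b: "b = 0 \<and> b0 = 1 \<or>
      b \<in> sign_vectors \<and> b0 = real CARD('n) - 1 \<and> \<beta>' = (\<Prod>i\<in>UNIV. - b $ i)"
    and van: "\<And>x. x \<in> sign_vectors \<Longrightarrow> b \<bullet> x + \<beta>' * (\<Prod>i\<in>UNIV. x $ i) + b0 = 0 \<Longrightarrow>
        c \<bullet> x + d * (\<Prod>i\<in>UNIV. x $ i) + k = 0"
  shows "\<exists>r. c = r *\<^sub>R b \<and> d = r * \<beta>' \<and> k = r * b0"
proof -
  have sq: "\<beta>' * \<beta>' = 1" using \<beta>' by auto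
  show ?thesis using b
  proof (elim disjE conjE)
    assume b: "b = 0" "b0 = 1"
    have "c = 0 \<and> - (d * \<beta>') + k = 0"
    proof (rule functional_on_parity_class[OF card])
      show "- \<beta>' \<in> {1, -1}" using \<beta>' by auto
      show "c \<bullet> x + (- (d * \<beta>') + k) = 0"
        if "x \<in> sign_vectors" "(\<Prod>i\<in>UNIV. x $ i) = - \<beta>'" for x
        using van[OF that(1)] that(2) b sq by simp
    qed
    then show ?thesis using b sq by (intro exI[of _ "d * \<beta>'"]) (auto simp: mult.assoc)
  next
    assume bs: "b \<in> sign_vectors" and b0: "b0 = real CARD('n) - 1"
      and \<beta>'_eq: "\<beta>' = (\<Prod>i\<in>UNIV. - b $ i)"
    have m: "- b \<in> sign_vectors" "(\<Prod>i\<in>UNIV. (- b) $ i) = \<beta>'"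
      using bs \<beta>'_eq by (auto simp: sign_vectors_def)
    have bb: "b \<bullet> b = real CARD('n)"
      by (simp add: inner_vec_def sign_vectors_square[OF bs])
    have base: "c \<bullet> (- b) + d * \<beta>' + k = 0"
      using van[OF m(1)] m(2) bb b0 sq by simp
    have c: "c $ i = (d * \<beta>') * b $ i" for i
    proof -
      have "c \<bullet> flip i (- b) + d * (- \<beta>') + k = 0"
        using van[OF flip_sign_vectors[OF m(1)], of i] sign_vectors_square[OF bs, of i] bb b0 sq
        unfolding prod_flip m(2) by (simp add: inner_flip)
      then have "c $ i * b $ i = d * \<beta>'" using base by (simp add: inner_flip)
      then have "c $ i * (b $ i * b $ i) = (d * \<beta>') * b $ i" by (simp add: algebra_simps)
      then show ?thesis by (simp add: sign_vectors_square[OF bs])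
    qed
    then have c': "c = (d * \<beta>') *\<^sub>R b" by (simp add: vec_eq_iff)
    have "k = (d * \<beta>') * b0" using base bb unfolding c' b0 by (simp add: algebra_simps)
    then show ?thesis using c' sq by (intro exI[of _ "d * \<beta>'"]) (auto simp: mult.assoc)
  qed
qed

lemma facets_of_product_hull:
  fixes b :: "real^'n"
  assumes card: "CARD('n) \<ge> 3" and \<beta>': "\<beta>' \<in> {1, -1}"
  shows "(\<forall>p \<in> convex hull product_vertices. 0 \<le> (b, \<beta>') \<bullet> p + b0) \<and>
      {p \<in> convex hull product_vertices. (b, \<beta>') \<bullet> p + b0 = 0} facet_of convex hull product_vertices
    \<longleftrightarrow> b = 0 \<and> b0 = 1 \<or>
      b \<in> sign_vectors \<and> b0 = real CARD('n) - 1 \<and> \<beta>' = (\<Prod>i\<in>UNIV. - b $ i)"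
    (is "?valid \<and> ?facet \<longleftrightarrow> ?list")
proof -
  have nz: "(b, \<beta>') \<noteq> 0" using \<beta>' by (auto simp: zero_prod_def)
  note crit = facet_iff_functionals_proportional[OF finite_product_vertices
      aff_dim_product_vertices[OF card] nz, of b0]
  have valid: "?valid \<longleftrightarrow>
      (\<forall>x \<in> sign_vectors. 0 \<le> b \<bullet> x + \<beta>' * (\<Prod>i\<in>UNIV. x $ i) + b0)"
    unfolding nonneg_on_convex_hull by (simp add: product_vertices_def)
  have facet: "?facet \<longleftrightarrow> (\<forall>c d k. (\<forall>x \<in> sign_vectors.
      b \<bullet> x + \<beta>' * (\<Prod>i\<in>UNIV. x $ i) + b0 = 0 \<longrightarrow> c \<bullet> x + d * (\<Prod>i\<in>UNIV. x $ i) + k = 0) \<longrightarrow>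
      (\<exists>r. c = r *\<^sub>R b \<and> d = r * \<beta>' \<and> k = r * b0))" if ?valid
  proof -
    have "?facet \<longleftrightarrow> (\<forall>h k. (\<forall>p\<in>product_vertices. (b, \<beta>') \<bullet> p + b0 = 0 \<longrightarrow> h \<bullet> p + k = 0) \<longrightarrow>
        (\<exists>r. h = r *\<^sub>R (b, \<beta>') \<and> k = r * b0))"
      by (rule crit) (use that hull_inc[of _ product_vertices] in blast)
    then show ?thesis by (simp add: product_vertices_def)
  qed
  show ?thesis
  proof
    assume "?valid \<and> ?facet"
    then have "?valid" "?facet" by auto
    show ?list
    proof (rule facet_imp_parity_or_sign[OF \<beta>'])
      show "0 \<le> b \<bullet> x + \<beta>' * (\<Prod>i\<in>UNIV. x $ i) + b0" if "x \<in> sign_vectors" for x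
        using \<open>?valid\<close> that unfolding valid by blast
      show "\<exists>r. c = r *\<^sub>R b \<and> d = r * \<beta>' \<and> k = r * b0"
        if "\<And>x. x \<in> sign_vectors \<Longrightarrow> b \<bullet> x + \<beta>' * (\<Prod>i\<in>UNIV. x $ i) + b0 = 0 \<Longrightarrow>
          c \<bullet> x + d * (\<Prod>i\<in>UNIV. x $ i) + k = 0" for c d k
        using \<open>?facet\<close> that unfolding facet[OF \<open>?valid\<close>] by blast
    qed
  next
    assume l: ?list
    have v: ?valid unfolding valid using parity_or_sign_nonneg[OF \<beta>' _ l] by blast
    show "?valid \<and> ?facet"
    proof
      show ?facet unfolding facet[OF v]
        using parity_or_sign_functionals[OF card \<beta>' l] by blast
    qed (rule v)
  qed
qed

section \<open>Sorted coefficient vectors\<close>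

lemma mono_sign_sequence_threshold:
  fixes \<beta> :: "nat \<Rightarrow> real"
  assumes mono: "mono_on {1..n} \<beta>" and sgn: "\<And>j. j \<in> {1..n} \<Longrightarrow> \<beta> j = 1 \<or> \<beta> j = -1"
  shows "\<exists>k\<le>n. \<forall>j\<in>{1..n}. \<beta> j = (if j \<le> k then -1 else 1)"
proof -
  define k where "k = Max (insert 0 {j \<in> {1..n}. \<beta> j = -1})"
  have fin: "finite (insert 0 {j \<in> {1..n}. \<beta> j = -1})" by simp
  have kin: "k \<in> insert 0 {j \<in> {1..n}. \<beta> j = -1}" unfolding k_def by (rule Max_in) auto
  have "\<beta> j = (if j \<le> k then -1 else 1)" if j: "j \<in> {1..n}" for j
  proof (cases "j \<le> k")
    case True
    then have k: "k \<in> {1..n}" "\<beta> k = -1" using kin j by auto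
    then have "\<beta> j \<le> -1" using mono_onD[OF mono j k(1) True] by simp
    then show ?thesis using sgn[OF j] True by auto
  next
    case False
    then have "\<beta> j \<noteq> -1" using Max_ge[OF fin, of j] j unfolding k_def by auto
    then show ?thesis using sgn[OF j] False by auto
  qed
  then show ?thesis using kin by (intro exI[of _ k]) auto
qed

text \<open>
  The values \<open>k = 0\<close> and \<open>k = n\<close> are the two forms whose coefficients at \<open>x\<close> all have one sign, and
  \<open>k = t + 1\<close> is the member of the remaining family with parameter \<open>t\<close>.
\<close>

definition threshold_form :: "nat \<Rightarrow> (nat \<Rightarrow> 'n) \<Rightarrow> nat \<Rightarrow> (real^'n) \<times> real \<Rightarrow> real" where
  "threshold_form n v k = (\<lambda>(x, y). (real n - 1)
     + (\<Sum>j=1..n. (if j \<le> k then -1 else 1) * x $ v j) + (-1) ^ (n - k) * y)"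

lemma prod_threshold:
  assumes "k \<le> n"
  shows "(\<Prod>j=1..n. if j \<le> k then 1 else -1 :: real) = (-1) ^ (n - k)"
proof -
  have "(\<Prod>j=1..n. if j \<le> k then 1 else -1 :: real)
      = (\<Prod>j\<in>{1..k}. if j \<le> k then 1 else -1) * (\<Prod>j\<in>{k+1..n}. if j \<le> k then 1 else -1)"
    using assms by (subst prod.union_disjoint[symmetric]) (auto intro!: arg_cong2[where f=prod])
  also have "(\<Prod>j\<in>{1..k}. if j \<le> k then 1 else -1 :: real) = 1" by (rule prod.neutral) auto
  also have "(\<Prod>j\<in>{k+1..n}. if j \<le> k then 1 else -1 :: real) = (\<Prod>j\<in>{k+1..n}. -1)"
    by (rule prod.cong) auto
  finally show ?thesis by simp
qed

lemma threshold_form_inner: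
  fixes v :: "nat \<Rightarrow> 'n::finite"
  assumes bij: "bij_betw v {1..n} UNIV"
    and b: "\<And>j. j \<in> {1..n} \<Longrightarrow> b $ v j = (if j \<le> k then -1 else 1)"
  shows "threshold_form n v k = (\<lambda>p. (b, (-1) ^ (n - k)) \<bullet> p + (real n - 1))"
proof -
  have "(\<Sum>j=1..n. (if j \<le> k then -1 else 1) * x $ v j) = b \<bullet> x" for x
  proof -
    have "(\<Sum>j=1..n. (if j \<le> k then -1 else 1) * x $ v j) = (\<Sum>j=1..n. b $ v j * x $ v j)"
      by (rule sum.cong) (use b in auto)
    also have "\<dots> = b \<bullet> x" unfolding inner_vec_def
      using sum.reindex_bij_betw[OF bij, of "\<lambda>i. b $ i * x $ i"] by simp
    finally show ?thesis .
  qed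
  then show ?thesis by (auto simp: threshold_form_def)
qed

text \<open>
  Passing from sums over the numbering \<open>v\<close> to inner products makes the facet criterion applicable; the
  numbering survives only in the monotonicity of the coefficients.
\<close>

lemma core_inequality_iff_inner:
  fixes v :: "nat \<Rightarrow> 'n::finite"
  assumes bij: "bij_betw v {1..n} UNIV"
  shows "core_inequality n v f \<longleftrightarrow> (\<exists>b0 b \<beta>'. \<beta>' \<in> {1, -1} \<and> mono_on {1..n} (\<lambda>j. b $ v j) \<and>
    f = (\<lambda>p. (b, \<beta>') \<bullet> p + b0))"
proof -
  have sum: "(\<Sum>j=1..n. b $ v j * x $ v j) = b \<bullet> x" for b x :: "real^'n"
    unfolding inner_vec_def using sum.reindex_bij_betw[OF bij, of "\<lambda>i. b $ i * x $ i"] by simp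
  show ?thesis
  proof
    assume "core_inequality n v f"
    then obtain b0 \<beta> \<beta>' where *: "\<beta>' \<in> {-1, 1}" "mono_on {1..n} \<beta>"
        "f = (\<lambda>(x, y). b0 + (\<Sum>j=1..n. \<beta> j * x $ v j) + \<beta>' * y)"
      unfolding core_inequality_def by blast
    define b where "b = (\<chi> i. \<beta> (inv_into {1..n} v i))"
    have bv: "b $ v j = \<beta> j" if "j \<in> {1..n}" for j
      using bij_betw_inv_into_left[OF bij that] by (simp add: b_def)
    have "(\<Sum>j=1..n. \<beta> j * x $ v j) = b \<bullet> x" for x
      unfolding sum[symmetric] by (rule sum.cong) (use bv in auto)
    then have "f = (\<lambda>p. (b, \<beta>') \<bullet> p + b0)" using *(3) by auto
    moreover have "mono_on {1..n} (\<lambda>j. b $ v j)" using *(2) bv by (auto simp: mono_on_def)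
    ultimately show "\<exists>b0 b \<beta>'. \<beta>' \<in> {1, -1} \<and> mono_on {1..n} (\<lambda>j. b $ v j) \<and>
        f = (\<lambda>p. (b, \<beta>') \<bullet> p + b0)" using *(1) by blast
  next
    assume "\<exists>b0 b \<beta>'. \<beta>' \<in> {1, -1} \<and> mono_on {1..n} (\<lambda>j. b $ v j) \<and>
        f = (\<lambda>p. (b, \<beta>') \<bullet> p + b0)"
    then obtain b0 b \<beta>' where *: "\<beta>' \<in> {1, -1}" "mono_on {1..n} (\<lambda>j. b $ v j)"
        "f = (\<lambda>p. (b, \<beta>') \<bullet> p + b0)" by blast
    have "f = (\<lambda>(x, y). b0 + (\<Sum>j=1..n. b $ v j * x $ v j) + \<beta>' * y)"
      unfolding sum *(3) by auto
    then show "core_inequality n v f" unfolding core_inequality_def using *(1,2) by blast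
  qed
qed

lemma core_facets_eq:
  fixes v :: "nat \<Rightarrow> 'n::finite" and m :: "real^'n \<Rightarrow> real"
  assumes n: "n \<ge> 3" and bij: "bij_betw v {1..n} UNIV"
    and m: "\<And>x. m x = (\<Prod>j=1..n. x $ v j)"
  shows "{f. core_facet n v m (-1) 1 f} =
    {\<lambda>(x, y). 1 - y, \<lambda>(x, y). 1 + y} \<union> threshold_form n v ` {0..n}"
proof -
  let ?P = "convex hull (product_vertices :: ((real^'n) \<times> real) set)"
  have CARD: "CARD('n) = n" using bij_betw_same_card[OF bij] by simp
  have reindex: "(\<Prod>i\<in>UNIV. g i) = (\<Prod>j=1..n. g (v j))" for g :: "'n \<Rightarrow> real"
    using prod.reindex_bij_betw[OF bij, of g] by simp
  have hull: "convex hull (graph_over_box m (-1) 1) = ?P"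
    by (rule convex_hull_graph_eq) (simp add: m reindex)
  have core: "core_facet n v m (-1) 1 f \<longleftrightarrow> (\<exists>b0 b \<beta>'. \<beta>' \<in> {1, -1} \<and> mono_on {1..n} (\<lambda>j. b $ v j) \<and>
      f = (\<lambda>p. (b, \<beta>') \<bullet> p + b0) \<and> (b = 0 \<and> b0 = 1 \<or>
      b \<in> sign_vectors \<and> b0 = real n - 1 \<and> \<beta>' = (\<Prod>i\<in>UNIV. - b $ i)))" for f
  proof -
    have "core_facet n v m (-1) 1 f \<longleftrightarrow> (\<exists>b0 b \<beta>'. \<beta>' \<in> {1, -1} \<and> mono_on {1..n} (\<lambda>j. b $ v j) \<and>
      f = (\<lambda>p. (b, \<beta>') \<bullet> p + b0) \<and> ((\<forall>p \<in> ?P. 0 \<le> (b, \<beta>') \<bullet> p + b0) \<and>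
        {p \<in> ?P. (b, \<beta>') \<bullet> p + b0 = 0} facet_of ?P))"
      unfolding core_facet_def valid_core_inequality_def core_inequality_iff_inner[OF bij] hull
      by blast
    also have "\<dots> \<longleftrightarrow> (\<exists>b0 b \<beta>'. \<beta>' \<in> {1, -1} \<and> mono_on {1..n} (\<lambda>j. b $ v j) \<and>
      f = (\<lambda>p. (b, \<beta>') \<bullet> p + b0) \<and> (b = 0 \<and> b0 = 1 \<or>
      b \<in> sign_vectors \<and> b0 = real n - 1 \<and> \<beta>' = (\<Prod>i\<in>UNIV. - b $ i)))"
      by (intro ex_cong1 conj_cong refl, rule facets_of_product_hull[where 'n='n, unfolded CARD, OF n])
    finally show ?thesis .
  qed
  have coreI: "core_facet n v m (-1) 1 (\<lambda>p. (b, \<beta>') \<bullet> p + b0)"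
    if "\<beta>' \<in> {1, -1}" "mono_on {1..n} (\<lambda>j. b $ v j)" "b = 0 \<and> b0 = 1 \<or>
      b \<in> sign_vectors \<and> b0 = real n - 1 \<and> \<beta>' = (\<Prod>i\<in>UNIV. - b $ i)" for b \<beta>' b0
    unfolding core using that by blast
  show ?thesis
  proof (intro set_eqI iffI)
    fix f assume "f \<in> {f. core_facet n v m (-1) 1 f}"
    then obtain b0 b \<beta>' where *: "\<beta>' \<in> {1, -1}" "mono_on {1..n} (\<lambda>j. b $ v j)"
        "f = (\<lambda>p. (b, \<beta>') \<bullet> p + b0)" and alt: "b = 0 \<and> b0 = 1 \<or>
        b \<in> sign_vectors \<and> b0 = real n - 1 \<and> \<beta>' = (\<Prod>i\<in>UNIV. - b $ i)"
      unfolding mem_Collect_eq core by blast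
    from alt show "f \<in> {\<lambda>(x, y). 1 - y, \<lambda>(x, y). 1 + y} \<union> threshold_form n v ` {0..n}"
    proof (elim disjE conjE)
      assume "b = 0" "b0 = 1"
      then show ?thesis using * by (auto simp: fun_eq_iff)
    next
      assume b: "b \<in> sign_vectors" "b0 = real n - 1" "\<beta>' = (\<Prod>i\<in>UNIV. - b $ i)"
      obtain k where k: "k \<le> n" "\<And>j. j \<in> {1..n} \<Longrightarrow> b $ v j = (if j \<le> k then -1 else 1)"
        using mono_sign_sequence_threshold[OF *(2)] sign_vectorsD[OF b(1)] by blast
      have "\<beta>' = (\<Prod>j=1..n. if j \<le> k then 1 else -1)"
        unfolding b(3) reindex by (rule prod.cong) (use k(2) in auto)
      then have "\<beta>' = (-1) ^ (n - k)" using prod_threshold[OF k(1)] by simp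
      then have "f = threshold_form n v k"
        using threshold_form_inner[OF bij k(2)] *(3) b(2) by simp
      then show ?thesis using k(1) by auto
    qed
  next
    fix f assume "f \<in> {\<lambda>(x, y). 1 - y, \<lambda>(x, y). 1 + y} \<union> threshold_form n v ` {0..n}"
    then consider "f = (\<lambda>p. (0, -1) \<bullet> p + 1)" | "f = (\<lambda>p. (0, 1) \<bullet> p + 1)"
      | k where "k \<le> n" "f = threshold_form n v k"
      by (auto simp: fun_eq_iff)
    then have "core_facet n v m (-1) 1 f"
    proof cases
      case 1
      then show ?thesis by (auto intro!: coreI simp: mono_on_def)
    next
      case 2
      then show ?thesis by (auto intro!: coreI simp: mono_on_def)
    next
      case 3
      define b :: "real^'n" where "b = (\<chi> i. if inv_into {1..n} v i \<le> k then -1 else 1)"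
      have bv: "b $ v j = (if j \<le> k then -1 else 1)" if "j \<in> {1..n}" for j
        using bij_betw_inv_into_left[OF bij that] by (simp add: b_def)
      have bs: "b \<in> sign_vectors" by (simp add: b_def sign_vectors_def)
      have "(\<Prod>i\<in>UNIV. - b $ i) = (\<Prod>j=1..n. if j \<le> k then 1 else -1)"
        unfolding reindex by (rule prod.cong) (use bv in auto)
      then have "(\<Prod>i\<in>UNIV. - b $ i) = (-1) ^ (n - k)" using prod_threshold[OF 3(1)] by simp
      moreover have "mono_on {1..n} (\<lambda>j. b $ v j)" using bv by (auto simp: mono_on_def)
      moreover have "(-1) ^ (n - k) \<in> {1, -1 :: real}"
        using neg_one_even_power neg_one_odd_power by blast
      moreover have "f = (\<lambda>p. (b, (-1) ^ (n - k)) \<bullet> p + (real n - 1))"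
        unfolding 3(2) by (rule threshold_form_inner[OF bij bv])
      ultimately show ?thesis using bs by (auto intro!: coreI)
    qed
    then show "f \<in> {f. core_facet n v m (-1) 1 f}" by simp
  qed
qed

text \<open>
  The coefficient at \<open>x\<^sub>i\<close> is recovered by evaluating at the unit vector in direction \<open>i\<close>; the forms
  for \<open>k < l\<close> differ in it at \<open>i = k + 1\<close>.
\<close>

lemma threshold_form_inj:
  fixes v :: "nat \<Rightarrow> 'n::finite"
  assumes bij: "bij_betw v {1..n} UNIV"
  shows "inj_on (threshold_form n v) {0..n}"
proof -
  have val: "threshold_form n v k (axis (v i) 1, 0) = (real n - 1) + (if i \<le> k then -1 else 1)"
    if i: "i \<in> {1..n}" for i k
  proof -
    have "(\<Sum>j=1..n. (if j \<le> k then -1 else 1) * axis (v i) 1 $ v j)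
        = (\<Sum>j=1..n. if j = i then (if j \<le> k then -1 else 1) else (0::real))"
      by (rule sum.cong)
         (use inj_onD[OF bij_betw_imp_inj_on[OF bij]] i in \<open>auto simp: axis_def\<close>)
    then show ?thesis using i by (simp add: threshold_form_def)
  qed
  show ?thesis
  proof (rule linorder_inj_onI)
    fix k l assume "k < l" "k \<in> {0..n}" "l \<in> {0..n}"
    then show "threshold_form n v k \<noteq> threshold_form n v l"
      using val[of "Suc k" k] val[of "Suc k" l] by auto
  qed auto
qed

theorem theorem6p1:
  fixes n :: nat and v :: "nat \<Rightarrow> 'n::finite" and m :: "real^'n \<Rightarrow> real"
  assumes "n \<ge> 3"
    and "bij_betw v {1..n} (UNIV :: 'n set)"
    and "\<And>x. m x = (\<Prod>j=1..n. x $ v j)"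
  shows "card {f. core_facet n v m (-1) 1 f} = n + 3 \<and>
    {f. core_facet n v m (-1) 1 f} =
      {\<lambda>(x, y). 1 - y,
       \<lambda>(x, y). 1 + y,
       \<lambda>(x, y). (real n - 1) + (\<Sum>j=1..n. x $ v j) + (-1) ^ n * y,
       \<lambda>(x, y). (real n - 1) - (\<Sum>j=1..n. x $ v j) + y} \<union>
      {\<lambda>(x, y). (real n - 1) - ((\<Sum>j=1..t+1. x $ v j) - (\<Sum>j=t+2..n. x $ v j))
          + (-1) ^ (n - (t + 1)) * y | t. t \<in> {0..n-2}}"
proof
  note eq = core_facets_eq[OF assms]
  let ?A = "{\<lambda>(x, y). 1 - y, \<lambda>(x, y). 1 + y} :: ((real^'n) \<times> real \<Rightarrow> real) set"
  have "(\<lambda>(x, y). 1 - y) \<noteq> (\<lambda>(x::real^'n, y). 1 + y :: real)"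
    by (auto simp: fun_eq_iff intro!: exI[of _ 1])
  then have cardA: "card ?A = 2" by simp
  \<comment> \<open>Compare constant terms: they are 1 and \<open>n - 1\<close>, which differ as \<open>n \<ge> 3\<close>.\<close>
  have disj: "?A \<inter> threshold_form n v ` {0..n} = {}"
  proof -
    have "f (0, 0) = 1" if "f \<in> ?A" for f using that by auto
    moreover have "threshold_form n v k (0, 0) \<noteq> 1" for k
      using assms(1) by (simp add: threshold_form_def)
    ultimately show ?thesis by fastforce
  qed
  show "card {f. core_facet n v m (-1) 1 f} = n + 3"
    unfolding eq using cardA disj card_image[OF threshold_form_inj[OF assms(2)]]
    by (subst card_Un_disjoint) auto
  have zero: "threshold_form n v 0 = (\<lambda>(x, y). (real n - 1) + (\<Sum>j=1..n. x $ v j) + (-1) ^ n * y)"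
    by (simp add: threshold_form_def)
  have top: "threshold_form n v n = (\<lambda>(x, y). (real n - 1) - (\<Sum>j=1..n. x $ v j) + y)"
    by (simp add: threshold_form_def sum_negf)
  have mid: "threshold_form n v (t + 1) =
      (\<lambda>(x, y). (real n - 1) - ((\<Sum>j=1..t+1. x $ v j) - (\<Sum>j=t+2..n. x $ v j))
          + (-1) ^ (n - (t + 1)) * y)" if "t \<in> {0..n-2}" for t
  proof -
    have un: "{1..n} = {1..t+1} \<union> {t+2..n}" using that assms(1) by auto
    have "(\<Sum>j=1..n. (if j \<le> t + 1 then -1 else 1) * x $ v j)
        = - (\<Sum>j=1..t+1. x $ v j) + (\<Sum>j=t+2..n. x $ v j)" for x :: "real^'n"
    proof -
      have "(\<Sum>j=1..n. (if j \<le> t + 1 then -1 else 1) * x $ v j)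
          = (\<Sum>j=1..t+1. (if j \<le> t + 1 then -1 else 1) * x $ v j)
            + (\<Sum>j=t+2..n. (if j \<le> t + 1 then -1 else 1) * x $ v j)"
        unfolding un by (rule sum.union_disjoint) auto
      also have "(\<Sum>j=1..t+1. (if j \<le> t + 1 then -1 else 1) * x $ v j) = (\<Sum>j=1..t+1. - x $ v j)"
        by (rule sum.cong) auto
      also have "(\<Sum>j=t+2..n. (if j \<le> t + 1 then -1 else 1) * x $ v j) = (\<Sum>j=t+2..n. x $ v j)"
        by (rule sum.cong) auto
      finally show ?thesis by (simp only: sum_negf)
    qed
    then show ?thesis by (simp add: threshold_form_def fun_eq_iff)
  qed
  have range: "{0..n} = {0, n} \<union> (\<lambda>t. t + 1) ` {0..n-2}"
  proof -
    have "k \<in> (\<lambda>t. t + 1) ` {0..n-2}" if "0 < k" "k < n" for k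
      by (rule image_eqI[of _ _ "k - 1"]) (use that in auto)
    then show ?thesis using assms(1) by force
  qed
  have "threshold_form n v ` (\<lambda>t. t + 1) ` {0..n-2} =
      {\<lambda>(x, y). (real n - 1) - ((\<Sum>j=1..t+1. x $ v j) - (\<Sum>j=t+2..n. x $ v j))
          + (-1) ^ (n - (t + 1)) * y | t. t \<in> {0..n-2}}"
    unfolding image_image Setcompr_eq_image by (rule image_cong) (use mid in auto)
  then show "{f. core_facet n v m (-1) 1 f} =
      {\<lambda>(x, y). 1 - y,
       \<lambda>(x, y). 1 + y,
       \<lambda>(x, y). (real n - 1) + (\<Sum>j=1..n. x $ v j) + (-1) ^ n * y,
       \<lambda>(x, y). (real n - 1) - (\<Sum>j=1..n. x $ v j) + y} \<union>
      {\<lambda>(x, y). (real n - 1) - ((\<Sum>j=1..t+1. x $ v j) - (\<Sum>j=t+2..n. x $ v j))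
          + (-1) ^ (n - (t + 1)) * y | t. t \<in> {0..n-2}}"
    unfolding eq range image_Un by (simp only: image_insert image_empty zero top) blast
qed

end
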